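(* Let $(x_k)_{k\ge0}$ be generated by algorithm CPG or CGD (see context) under the assumptions stated there, with $i_k$ chosen cyclically, and assume that for some constant $C>0$, $$F(x_k)-F(x_{k+N})\ge C\|\nabla F(x_k)\|^2\qquad\forall k\ge0 .$$ Then for every $k\ge1$, $$\min_{0\le i\le k-1}\|\nabla F(x_i)\|^2\le\frac{N\,(F(x_0)-F^* )}{Ck}.$$
   Context: Setting: $F=f+\psi$ with $f,\psi:\mathbb{R}^n\to\mathbb{R}$, $f$ differentiable, both possibly nonconvex; $F^*=\min F$. $U=[U_1,\dots,U_N]\in\mathbb{R}^{n\times n}$ is a column permutation of $I_n$, split into $U_i\in\mathbb{R}^{n\times n_i}$, $\sum_i n_i=n$. Norms are Euclidean / induced operator norms. Cyclic choice: $i_k=(k\bmod N)+1$. Assumptions. A.1: $\|U_i^T(\nabla f(x+U_ih)-\nabla f(x))\|\le L_i\|h\|$ for all $h,x,i$. A.2: $\psi$ is twice continuously differentiable. A.3: $F$ attains its minimum $F^*>-\infty$. Algorithm CPG: fix $\eta_i>0$; $H_{f,U_i}=\frac{L_i+\eta_i}{2}$ if $d\mapsto\psi(x+U_id)$ is convex for all $x,i$, else $H_{f,U_i}=L_i+\eta_i$. Given $x_0$, for $k\ge0$: choose $i_k$; take $d_k\in\arg\min_{d\in\mathbb{R}^{n_{i_k}}}f(x_k)+\langle U_{i_k}^T\nabla f(x_k),d\rangle+\frac{H_{f,U_{i_k}}}{2}\|d\|^2+\psi(x_k+U_{i_k}d)$ (assumed to exist); $x_{k+1}=x_k+U_{i_k}d_k$.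 Algorithm CGD: fix $\eta_i>0$; $H_{f,U_i}=\frac{L_i+\eta_i}{2}$. Given $x_0$, for $k\ge0$: choose $i_k$, compute $H_{F_k}$ by one of the rules below, $d_k=-\frac1{H_{F_k}}U_{i_k}^T\nabla F(x_k)$, $x_{k+1}=x_k+U_{i_k}d_k$. The same rule is used for all $k$, and $\psi$ satisfies the assumption attached to it: Rule 1 (A.4 and A.5): $\alpha_k\ge0$ root of $\frac{L_\psi}{6}\alpha^2+(\frac{H_\psi}{2}\|x_k\|^p+H_{f,U_{i_k}})\alpha=\|U_{i_k}^T\nabla F(x_k)\|$; $H_{F_k}=\frac{H_\psi}{2}\|x_k\|^p+\frac{L_\psi}{6}\alpha_k+H_{f,U_{i_k}}$. Rule 2 (A.4): $\alpha_k\ge0$ root of $2^{p-1}H_\psi\alpha^{p+1}+(2^{p-1}H_\psi\|x_k\|^p+H_{f,U_{i_k}})\alpha=\|U_{i_k}^T\nabla F(x_k)\|$; $H_{F_k}=2^{p-1}H_\psi\|x_k\|^p+2^{p-1}H_\psi\alpha_k^p+H_{f,U_{i_k}}$. Rule 3 (A.5): $\alpha_k\ge0$ root of $\frac{L_\psi}{6}\alpha^2+(\frac{L_\psi}{2}\|x_k-x_0\|+\frac12\|\nabla^2\psi(x_0)\|+H_{f,U_{i_k}})\alpha=\|U_{i_k}^T\nabla F(x_k)\|$; $H_{F_k}=\frac{L_\psi}{2}\|x_k-x_0\|+\frac12\|\nabla^2\psi(x_0)\|+\frac{L_\psi}{6}\alpha_k+H_{f,U_{i_k}}$. Rule 4 (A.6):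 $H_{F_k}=H_{f,U_{i_k}}$. Here A.4: $\|U_i^T\nabla^2\psi(y)U_i\|\le H_\psi\|y\|^p$ for all $y,i$ ($H_\psi>0$, integer $p\ge1$); A.5: $\|\nabla^2\psi(y)-\nabla^2\psi(x)\|\le L_\psi\|y-x\|$ for all $x,y$ ($L_\psi>0$); A.6: $\psi(x+U_id)\le\psi(x)+\langle U_i^T\nabla\psi(x),d\rangle$ for all $x,d,i$. *)

theory Defs
  imports "HOL-Analysis.Analysis"
begin

definition grad :: "(real^'n \<Rightarrow> real) \<Rightarrow> real^'n \<Rightarrow> real^'n" where
  "grad g x = (THE D. GDERIV g x :> D)"

lemma grad_eqI: "GDERIV g x :> D \<Longrightarrow> grad g x = D"
  unfolding grad_def
proof (rule the_equality)
  fix E assume "GDERIV g x :> D" "GDERIV g x :> E"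
  then have "(\<lambda>h. inner h D) = (\<lambda>h. inner h E)"
    unfolding gderiv_def by (rule has_derivative_unique)
  then have "\<forall>h. inner h D = inner h E"
    by (simp add: fun_eq_iff)
  then show "E = D"
    by (simp add: vector_eq_ldot)
qed

definition hessian :: "(real^'n \<Rightarrow> real) \<Rightarrow> real^'n \<Rightarrow> real^'n^'n" where
  "hessian g x = jacobian (grad g) (at x)"

definition twice_cont_diff :: "(real^'n \<Rightarrow> real) \<Rightarrow> bool" where
  "twice_cont_diff g \<longleftrightarrow>
     (\<forall>x. g differentiable (at x)) \<and>
     (\<forall>x. grad g differentiable (at x)) \<and>
     continuous_on UNIV (hessian g)"

definition opnorm :: "real^'n^'m \<Rightarrow> real" where
  "opnorm A = onorm ((*v) A)"


text \<open>
  The columns of U are distributed among the blocks by their index sets S 1, ..., S N,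
  so that \<open>n\<^sub>i = card (S i)\<close>.  As the number of columns cannot depend on i within a type,
  the space of \<open>n\<^sub>i\<close>-dimensional real vectors is realised as the coordinate subspace of vectors supported
  on \<open>S i\<close>, and \<open>U\<^sub>i\<close> is U with the columns outside \<open>S i\<close> set to zero.  Inner products,
  Euclidean norms and operator norms are unaffected by this padding with zeros, and
  \<open>transpose U\<^sub>i *v v\<close> always lies in that subspace.
\<close>

definition block_space :: "'n set \<Rightarrow> (real^'n) set" where
  "block_space J = {d. \<forall>c. c \<notin> J \<longrightarrow> d $ c = 0}"

definition block_mat :: "real^'n^'n \<Rightarrow> 'n set \<Rightarrow> real^'n^'n" where
  "block_mat U J = (\<chi> r c. if c \<in> J then U $ r $ c else 0)"

definition column_permutation_of_identity :: "real^'n^'n \<Rightarrow> bool" where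
  "column_permutation_of_identity U \<longleftrightarrow>
     (\<exists>\<pi>. bij \<pi> \<and> (\<forall>c. column c U = column (\<pi> c) (mat 1)))"

definition block_decomposition :: "real^'n^'n \<Rightarrow> (nat \<Rightarrow> 'n set) \<Rightarrow> nat \<Rightarrow> bool" where
  "block_decomposition U S N \<longleftrightarrow>
     column_permutation_of_identity U \<and>
     disjoint_family_on S {1..N} \<and> (\<Union>i\<in>{1..N}. S i) = UNIV"


definition block_lipschitz_grad ::
  "real^'n^'n \<Rightarrow> (nat \<Rightarrow> 'n set) \<Rightarrow> nat \<Rightarrow> (nat \<Rightarrow> real) \<Rightarrow> (real^'n \<Rightarrow> real) \<Rightarrow> bool" where
  "block_lipschitz_grad U S N L f \<longleftrightarrow>
     (\<forall>i\<in>{1..N}. \<forall>x. \<forall>h\<in>block_space (S i).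
        norm (transpose (block_mat U (S i)) *v
                (grad f (x + block_mat U (S i) *v h) - grad f x)) \<le> L i * norm h)"

definition block_hessian_growth ::
  "real^'n^'n \<Rightarrow> (nat \<Rightarrow> 'n set) \<Rightarrow> nat \<Rightarrow> real \<Rightarrow> nat \<Rightarrow> (real^'n \<Rightarrow> real) \<Rightarrow> bool" where
  "block_hessian_growth U S N H\<psi> p \<psi> \<longleftrightarrow>
     H\<psi> > 0 \<and> p \<ge> 1 \<and>
     (\<forall>i\<in>{1..N}. \<forall>y.
        opnorm (transpose (block_mat U (S i)) ** hessian \<psi> y ** block_mat U (S i))
          \<le> H\<psi> * norm y ^ p)"

definition lipschitz_hessian :: "real \<Rightarrow> (real^'n \<Rightarrow> real) \<Rightarrow> bool" where
  "lipschitz_hessian L\<psi> \<psi> \<longleftrightarrow>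
     L\<psi> > 0 \<and> (\<forall>x y. opnorm (hessian \<psi> y - hessian \<psi> x) \<le> L\<psi> * norm (y - x))"

definition block_concave ::
  "real^'n^'n \<Rightarrow> (nat \<Rightarrow> 'n set) \<Rightarrow> nat \<Rightarrow> (real^'n \<Rightarrow> real) \<Rightarrow> bool" where
  "block_concave U S N \<psi> \<longleftrightarrow>
     (\<forall>i\<in>{1..N}. \<forall>x. \<forall>d\<in>block_space (S i).
        \<psi> (x + block_mat U (S i) *v d)
          \<le> \<psi> x + (transpose (block_mat U (S i)) *v grad \<psi> x) \<bullet> d)"


definition cyclic_index :: "nat \<Rightarrow> nat \<Rightarrow> nat" where
  "cyclic_index N k = k mod N + 1"


definition CPG_const ::
  "real^'n^'n \<Rightarrow> (nat \<Rightarrow> 'n set) \<Rightarrow> nat \<Rightarrow> (nat \<Rightarrow> real) \<Rightarrow> (nat \<Rightarrow> real) \<Rightarrow>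
   (real^'n \<Rightarrow> real) \<Rightarrow> nat \<Rightarrow> real" where
  "CPG_const U S N L \<eta> \<psi> i =
     (if \<forall>j\<in>{1..N}. \<forall>x. convex_on (block_space (S j)) (\<lambda>d. \<psi> (x + block_mat U (S j) *v d))
      then (L i + \<eta> i) / 2 else L i + \<eta> i)"

definition CPG_sequence ::
  "real^'n^'n \<Rightarrow> (nat \<Rightarrow> 'n set) \<Rightarrow> nat \<Rightarrow> (nat \<Rightarrow> real) \<Rightarrow> (nat \<Rightarrow> real) \<Rightarrow>
   (real^'n \<Rightarrow> real) \<Rightarrow> (real^'n \<Rightarrow> real) \<Rightarrow> (nat \<Rightarrow> nat) \<Rightarrow> (nat \<Rightarrow> real^'n) \<Rightarrow> bool" where
  "CPG_sequence U S N L \<eta> f \<psi> idx x \<longleftrightarrow>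
     (\<forall>k. let J = S (idx k); Ui = block_mat U J in
        \<exists>d. is_arg_min
              (\<lambda>d. f (x k) + (transpose Ui *v grad f (x k)) \<bullet> d
                   + CPG_const U S N L \<eta> \<psi> (idx k) / 2 * (norm d)\<^sup>2
                   + \<psi> (x k + Ui *v d))
              (\<lambda>d. d \<in> block_space J) d \<and>
            x (Suc k) = x k + Ui *v d)"


text \<open>
  In the rules below, the arguments are the constant \<open>H\<^bsub>f,U\<^sub>i\<^esub>\<close> of the selected block (Hf),
  the norm G of the block gradient of F, the current iterate xk (together with the initial
  point x0 in the third rule), and the resulting value H.
\<close>

definition rule1 ::
  "real \<Rightarrow> nat \<Rightarrow> real \<Rightarrow> real \<Rightarrow> real \<Rightarrow> real^'n \<Rightarrow> real \<Rightarrow> bool" where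
  "rule1 H\<psi> p L\<psi> Hf G xk H \<longleftrightarrow>
     (\<exists>\<alpha>\<ge>0. L\<psi> / 6 * \<alpha>\<^sup>2 + (H\<psi> / 2 * norm xk ^ p + Hf) * \<alpha> = G \<and>
            H = H\<psi> / 2 * norm xk ^ p + L\<psi> / 6 * \<alpha> + Hf)"

definition rule2 ::
  "real \<Rightarrow> nat \<Rightarrow> real \<Rightarrow> real \<Rightarrow> real^'n \<Rightarrow> real \<Rightarrow> bool" where
  "rule2 H\<psi> p Hf G xk H \<longleftrightarrow>
     (\<exists>\<alpha>\<ge>0. 2 ^ (p - 1) * H\<psi> * \<alpha> ^ (p + 1)
              + (2 ^ (p - 1) * H\<psi> * norm xk ^ p + Hf) * \<alpha> = G \<and>
            H = 2 ^ (p - 1) * H\<psi> * norm xk ^ p + 2 ^ (p - 1) * H\<psi> * \<alpha> ^ p + Hf)"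

definition rule3 ::
  "real \<Rightarrow> (real^'n \<Rightarrow> real) \<Rightarrow> real^'n \<Rightarrow> real \<Rightarrow> real \<Rightarrow> real^'n \<Rightarrow> real \<Rightarrow> bool" where
  "rule3 L\<psi> \<psi> x0 Hf G xk H \<longleftrightarrow>
     (\<exists>\<alpha>\<ge>0. L\<psi> / 6 * \<alpha>\<^sup>2
              + (L\<psi> / 2 * norm (xk - x0) + 1 / 2 * opnorm (hessian \<psi> x0) + Hf) * \<alpha> = G \<and>
            H = L\<psi> / 2 * norm (xk - x0) + 1 / 2 * opnorm (hessian \<psi> x0) + L\<psi> / 6 * \<alpha> + Hf)"

definition rule4 :: "real \<Rightarrow> real \<Rightarrow> real^'n \<Rightarrow> real \<Rightarrow> bool" where
  "rule4 Hf G xk H \<longleftrightarrow> H = Hf"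

definition CGD_steps ::
  "(real \<Rightarrow> real \<Rightarrow> real^'n \<Rightarrow> real \<Rightarrow> bool) \<Rightarrow>
   real^'n^'n \<Rightarrow> (nat \<Rightarrow> 'n set) \<Rightarrow> (nat \<Rightarrow> real) \<Rightarrow> (nat \<Rightarrow> real) \<Rightarrow>
   (real^'n \<Rightarrow> real) \<Rightarrow> (nat \<Rightarrow> nat) \<Rightarrow> (nat \<Rightarrow> real^'n) \<Rightarrow> bool" where
  "CGD_steps rule U S L \<eta> F idx x \<longleftrightarrow>
     (\<forall>k. let i = idx k; Ui = block_mat U (S i); g = transpose Ui *v grad F (x k) in
        \<exists>H. rule ((L i + \<eta> i) / 2) (norm g) (x k) H \<and>
            x (Suc k) = x k + Ui *v (- (1 / H) *\<^sub>R g))"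

definition CGD_sequence ::
  "real^'n^'n \<Rightarrow> (nat \<Rightarrow> 'n set) \<Rightarrow> nat \<Rightarrow> (nat \<Rightarrow> real) \<Rightarrow> (nat \<Rightarrow> real) \<Rightarrow>
   real \<Rightarrow> nat \<Rightarrow> real \<Rightarrow> (real^'n \<Rightarrow> real) \<Rightarrow> (real^'n \<Rightarrow> real) \<Rightarrow>
   (nat \<Rightarrow> nat) \<Rightarrow> (nat \<Rightarrow> real^'n) \<Rightarrow> bool" where
  "CGD_sequence U S N L \<eta> H\<psi> p L\<psi> f \<psi> idx x \<longleftrightarrow>
     (let steps = (\<lambda>rule. CGD_steps rule U S L \<eta> (\<lambda>z. f z + \<psi> z) idx x) in
        block_hessian_growth U S N H\<psi> p \<psi> \<and> lipschitz_hessian L\<psi> \<psi> \<and> steps (rule1 H\<psi> p L\<psi>) \<or>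
        block_hessian_growth U S N H\<psi> p \<psi> \<and> steps (rule2 H\<psi> p) \<or>
        lipschitz_hessian L\<psi> \<psi> \<and> steps (rule3 L\<psi> \<psi> (x 0)) \<or>
        block_concave U S N \<psi> \<and> steps rule4)"

end

(* The iterates 0, N, 2N, ... below k number at least k/N, and the N-step decreases telescope
   along them. *)
theory Submission
  imports Defs
begin

text \<open>Sampling every N-th iterate turns the N-step decrease into a telescoping sum: the
  decreases at 0, N, 2N, ... add up to at most F(x_0) - F*, and each is at least C times the
  smallest squared gradient norm seen. At least k/N sampled indices lie below k, which produces the
  factor N. \<open>Min_le_of_N_step_decrease\<close> carries this out for real sequences, with
  \<open>a i\<close> = F(x_i), \<open>g i\<close> the squared gradient norm and \<open>l\<close> =
  F*.\<close>

lemma Min_le_of_N_step_decrease: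
  fixes a g :: "nat \<Rightarrow> real" and N k :: nat
  assumes "N > 0" "k \<ge> 1" "C > 0"
    and decrease: "\<And>i. C * g i \<le> a i - a (i + N)"
    and lower: "\<And>i. l \<le> a i"
  shows "(MIN i\<in>{0..k-1}. g i) \<le> real N * (a 0 - l) / (C * real k)"
proof -
  define m where "m = (MIN i\<in>{0..k-1}. g i)"
  \<comment> \<open>The number of multiples of \<open>N\<close> in \<open>{0..k-1}\<close>, that is,
    k/N rounded up.\<close>
  define M where "M = (k - 1) div N + 1"
  have "k - 1 < M * N"
    unfolding M_def using dividend_less_div_times[of N "k - 1"] \<open>N > 0\<close> by (simp add: add.commute)
  then have "k \<le> M * N" using \<open>k \<ge> 1\<close> by linarith
  then have k_le: "real k \<le> real M * real N" by (metis of_nat_le_iff of_nat_mult)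
  have m_le: "C * m \<le> a (j * N) - a (Suc j * N)" if "j < M" for j
  proof -
    have "j \<le> (k - 1) div N" using that by (simp add: M_def)
    then have "j * N \<le> k - 1"
      by (metis div_times_less_eq_dividend le_trans mult_le_mono1)
    then have "m \<le> g (j * N)" unfolding m_def by (intro Min_le) auto
    then have "C * m \<le> C * g (j * N)" using \<open>C > 0\<close> by simp
    also have "\<dots> \<le> a (j * N) - a (Suc j * N)"
      using decrease[of "j * N"] by (simp add: add.commute)
    finally show ?thesis .
  qed
  have "real M * (C * m) = (\<Sum>j<M. C * m)" by simp
  also have "\<dots> \<le> (\<Sum>j<M. a (j * N) - a (Suc j * N))"
    using m_le by (intro sum_mono) simp
  also have "\<dots> = a 0 - a (M * N)"
    by (subst sum_lessThan_telescope') simp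
  \<comment> \<open>The endpoint \<open>M * N\<close> is at least \<open>k\<close>, outside the
    range of the minimum; only the lower bound is needed there.\<close>
  also have "\<dots> \<le> a 0 - l" using lower by simp
  finally have total: "real M * (C * m) \<le> a 0 - l" .
  have "C * real k * m \<le> real N * (a 0 - l)"
  \<comment> \<open>Multiplying \<open>k_le\<close> by \<open>C * m\<close> keeps its direction only
    for nonnegative \<open>m\<close>; for negative \<open>m\<close> the two sides are separated by
    0.\<close>
  proof (cases "m \<ge> 0")
    case True
    have "real k * (C * m) \<le> real N * (real M * (C * m))"
      using mult_right_mono[OF k_le, of "C * m"] True \<open>C > 0\<close> by (simp add: mult_ac)
    also have "\<dots> \<le> real N * (a 0 - l)" using total by (intro mult_left_mono) auto
    finally show ?thesis by (simp add: mult_ac)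
  next
    case False
    then have "C * real k * m \<le> 0" using \<open>C > 0\<close> by (simp add: mult_nonneg_nonpos)
    also have "\<dots> \<le> real N * (a 0 - l)" using lower by simp
    finally show ?thesis .
  qed
  then show ?thesis
    using \<open>C > 0\<close> \<open>k \<ge> 1\<close> by (simp add: m_def pos_le_divide_eq mult_ac)
qed

theorem mainTheorem8:
  fixes f \<psi> F :: "real^'n \<Rightarrow> real"
    and U :: "real^'n^'n"
    and S :: "nat \<Rightarrow> 'n set"
    and N p :: nat
    and L \<eta> :: "nat \<Rightarrow> real"
    and H\<psi> L\<psi> Fstar C :: real
    and x :: "nat \<Rightarrow> real^'n"
  assumes F_def: "F = (\<lambda>z. f z + \<psi> z)"
    and f_diff: "\<forall>z. f differentiable (at z)"
    and blocks: "block_decomposition U S N"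
    and A1: "block_lipschitz_grad U S N L f"
    and A2: "twice_cont_diff \<psi>"
    and A3: "Fstar \<in> range F" "\<forall>z. Fstar \<le> F z"
    and eta_pos: "\<forall>i\<in>{1..N}. \<eta> i > 0"
    and alg: "CPG_sequence U S N L \<eta> f \<psi> (cyclic_index N) x \<or>
              CGD_sequence U S N L \<eta> H\<psi> p L\<psi> f \<psi> (cyclic_index N) x"
    and C_pos: "C > 0"
    and descent: "\<forall>k. F (x k) - F (x (k + N)) \<ge> C * (norm (grad F (x k)))\<^sup>2"
  shows "\<forall>k\<ge>1. (MIN i\<in>{0..k-1}. (norm (grad F (x i)))\<^sup>2) \<le> real N * (F (x 0) - Fstar) / (C * real k)"
proof (intro allI impI)
  fix k :: nat assume "k \<ge> 1"
  \<comment> \<open>With \<open>N = 0\<close> an empty union of blocks would have to cover the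
    nonempty index type.\<close>
  have "N > 0" using blocks by (cases N) (auto simp: block_decomposition_def)
  then show "(MIN i\<in>{0..k-1}. (norm (grad F (x i)))\<^sup>2) \<le> real N * (F (x 0) - Fstar) / (C * real k)"
    using Min_le_of_N_step_decrease[of N k C "\<lambda>i. (norm (grad F (x i)))\<^sup>2" "\<lambda>i. F (x i)" Fstar]
      \<open>k \<ge> 1\<close> C_pos descent A3(2) by simp
qed

end
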